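(* In the setting of the context (in particular, with discrete subspaces $X_h\subset X$, $Y_h\subset Y$ satisfying the Fortin hypothesis stated there), let $x\in D$ be a regular solution to $B(x)=F$. Then there exist positive constants $\varepsilon>0$ and $C(x,\varepsilon)>0$ such that any solution $(x_h,y_h)\in X_h\times Y_h$ (with $x_h\in D$) to the mixed problem $$a(y_h,\eta_h)+b(x_h;\eta_h)=F(\eta_h)\ \text{ for all }\eta_h\in Y_h,\qquad b'(x_h;\xi_h,y_h)=0\ \text{ for all }\xi_h\in X_h$$ with $\|x-x_h\|_X<\varepsilon$ satisfies $$\|x-x_h\|_X+\|y_h\|_Y\le C(x,\varepsilon)\inf_{\xi_h\in X_h}\|x-\xi_h\|_X .$$
   Context: $X$ is a real Banach space, $\emptyset\ne D\subset X$ is open, $Y$ is a real Hilbert space with scalar product $a$ and norm $\|y\|_Y=a(y,y)^{1/2}$, $F\in Y^*$, and $B\in C^1(D;Y^* )$ is a (nonlinear) map with Fréchet derivative $\mathrm{D}B(x)\in L(X;Y^* )$ at $x\in D$. Write $b(x;\eta):=\langle B(x),\eta\rangle$ and $b'(x;\xi,\eta):=\langle\mathrm{D}B(x)\xi,\eta\rangle$ for $x\in D$, $\xi\in X$, $\eta\in Y$. A regular solution is a point $x\in D$ with $B(x)=F$ such that $\mathrm{D}B(x)$ is a bijection from $X$ onto $Y^*$. $X_h\subset X$ and $Y_h\subset Y$ are discrete (finite-dimensional) subspaces and $D_h:=D\cap X_h$. Fortin hypothesis: there exists a linear bounded projection $\Pi_h:Y\to Y_h$ with $\Pi_h|_{Y_h}=\mathrm{id}|_{Y_h}$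 and $b'(x_h;\xi_h,y-\Pi_hy)=0$ for all $x_h\in D_h$, $\xi_h\in X_h$, $y\in Y$. *)

theory Defs
  imports "HOL-Analysis.Analysis"
begin

text \<open>
  Throughout, \<open>X\<close> is a type of class \<open>banach\<close> and \<open>Y\<close> a type of class
  \<open>{real_inner, complete_space}\<close>, so that the scalar product \<open>a\<close> is \<open>inner\<close>; the dual of \<open>Y\<close>
  is \<open>'y \<Rightarrow>\<^sub>L real\<close> and duality pairings are applications of bounded linear functions:
  \<open>b(x; \<eta>) = B x \<eta>\<close> and \<open>b'(x; \<xi>, \<eta>) = (DB x \<xi>) \<eta>\<close>.
\<close>

text \<open>
  Since \<open>D\<close> is open, \<open>DB\<close> is determined by \<open>B\<close> on \<open>D\<close>; its values outside \<open>D\<close> play no role.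
\<close>

definition C1_on ::
  "'x::real_normed_vector set \<Rightarrow> ('x \<Rightarrow> 'z::real_normed_vector) \<Rightarrow> ('x \<Rightarrow> 'x \<Rightarrow>\<^sub>L 'z) \<Rightarrow> bool" where
  "C1_on D B DB \<longleftrightarrow>
     (\<forall>x\<in>D. (B has_derivative blinfun_apply (DB x)) (at x)) \<and> continuous_on D DB"

definition regular_solution ::
  "'x::real_normed_vector set \<Rightarrow> ('x \<Rightarrow> 'y::real_normed_vector \<Rightarrow>\<^sub>L real) \<Rightarrow>
   ('x \<Rightarrow> 'x \<Rightarrow>\<^sub>L ('y \<Rightarrow>\<^sub>L real)) \<Rightarrow> ('y \<Rightarrow>\<^sub>L real) \<Rightarrow> 'x \<Rightarrow> bool" where
  "regular_solution D B DB F x \<longleftrightarrow> x \<in> D \<and> B x = F \<and> bij (blinfun_apply (DB x))"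

definition finite_dim_subspace :: "'v::real_vector set \<Rightarrow> bool" where
  "finite_dim_subspace V \<longleftrightarrow> subspace V \<and> (\<exists>S. finite S \<and> span S = V)"

text \<open>
  The norm of the Fortin operator is the only quantity of the discretization on which constants in
  quasi-optimality estimates may depend; uniformity over discretizations is therefore expressed
  by a bound \<open>norm P \<le> M\<close>.
\<close>

definition fortin_operator ::
  "'x::real_normed_vector set \<Rightarrow> ('x \<Rightarrow> 'x \<Rightarrow>\<^sub>L ('y::real_normed_vector \<Rightarrow>\<^sub>L real)) \<Rightarrow>
   'x set \<Rightarrow> 'y set \<Rightarrow> ('y \<Rightarrow>\<^sub>L 'y) \<Rightarrow> bool" where
  "fortin_operator D DB Xh Yh P \<longleftrightarrow>
     range (blinfun_apply P) \<subseteq> Yh \<and> (\<forall>\<eta>\<in>Yh. P \<eta> = \<eta>) \<and>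
     (\<forall>xh \<in> D \<inter> Xh. \<forall>\<xi>\<in>Xh. \<forall>y. blinfun_apply (DB xh \<xi>) (y - P y) = 0)"

definition mixed_solution ::
  "'x::real_normed_vector set \<Rightarrow> ('x \<Rightarrow> 'y::real_inner \<Rightarrow>\<^sub>L real) \<Rightarrow>
   ('x \<Rightarrow> 'x \<Rightarrow>\<^sub>L ('y \<Rightarrow>\<^sub>L real)) \<Rightarrow> ('y \<Rightarrow>\<^sub>L real) \<Rightarrow>
   'x set \<Rightarrow> 'y set \<Rightarrow> 'x \<Rightarrow> 'y \<Rightarrow> bool" where
  "mixed_solution D B DB F Xh Yh xh yh \<longleftrightarrow>
     xh \<in> D \<inter> Xh \<and> yh \<in> Yh \<and>
     (\<forall>\<eta>\<in>Yh. inner yh \<eta> + blinfun_apply (B xh) \<eta> = blinfun_apply F \<eta>) \<and>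
     (\<forall>\<xi>\<in>Xh. blinfun_apply (DB xh \<xi>) yh = 0)"

end

theory Submission
  imports Defs
begin

text \<open>
  Quasi-optimality follows from a perturbation argument around the regular solution. By the bounded
  inverse theorem \<open>DB x\<close> is bounded below, and so is \<open>DB xh\<close> for \<open>xh\<close> close to \<open>x\<close>. The Fortin
  operator reduces the dual norm of \<open>DB xh w\<close>, for \<open>w \<in> Xh\<close>, to tests with \<open>\<eta> \<in> Yh\<close>, where the
  first equation of the mixed problem identifies \<open>DB xh (xh - \<xi>)\<close>, up to the linearization error,
  with \<open>DB xh (x - \<xi>) - yh\<close>. Testing with \<open>yh\<close> itself, which \<open>DB xh w\<close> annihilates, controls
  \<open>norm yh\<close>. The linearization error is a small multiple of \<open>norm (x - xh)\<close> and is absorbed.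
\<close>

section \<open>The bounded inverse theorem\<close>

text \<open>This is the Baire half of the open mapping theorem: the closures of the images of balls
  cover the complete target, so one of them has an interior point. Symmetry moves that point to the
  origin, and scaling extends the estimate to all \<open>y\<close>.\<close>

lemma surj_blinfun_approximate_preimage:
  fixes T :: "'a::real_normed_vector \<Rightarrow>\<^sub>L 'b::banach"
  assumes surj: "surj (blinfun_apply T)"
  obtains K where "K \<ge> 0" "\<And>y. \<exists>x. norm x \<le> K * norm y \<and> norm (y - T x) \<le> norm y / 2"
proof -
  define S where "S n = closure (blinfun_apply T ` cball 0 (real n))" for n :: nat
  have union: "\<Union> (range S) = UNIV"
  proof (intro equalityI subsetI UNIV_I)
    fix y
    obtain x where x: "y = T x"
      using surj by (metis surjD)
    obtain n :: nat where "norm x \<le> real n"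
      using real_arch_simple by blast
    then have "y \<in> S n"
      unfolding S_def x by (intro subsetD[OF closure_subset]) auto
    then show "y \<in> \<Union> (range S)"
      by blast
  qed
  have "\<exists>n. interior (S n) \<noteq> {}"
  proof (rule ccontr)
    assume "\<nexists>n. interior (S n) \<noteq> {}"
    then have "(euclidean :: 'b topology) interior_of \<Union> (range S) = {}"
      by (intro Baire_category_alt)
        (auto simp: S_def completely_metrizable_space_euclidean)
    then show False
      using union by simp
  qed
  then obtain n z where "z \<in> interior (S n)"
    by blast
  then obtain r where r: "r > 0" "ball z r \<subseteq> S n"
    by (meson mem_interior)
  have approx: "\<exists>x. norm x \<le> real n \<and> norm (y - T x) < \<delta>" if y: "norm y < r" and "\<delta> > 0" for y \<delta>
  proof -
    \<comment> \<open>Since \<open>y\<close> is half the difference of \<open>z + y\<close> and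
      \<open>z - y\<close>, averaging approximate preimages of both cancels the unknown centre
      \<open>z\<close>.\<close>
    have "z + y \<in> S n" "z - y \<in> S n"
      using r y by (auto simp: subset_iff dist_norm)
    then obtain u v where u: "norm u \<le> real n" "norm (T u - (z + y)) < \<delta>"
      and v: "norm (T v - (z - y)) < \<delta>" "norm v \<le> real n"
      using \<open>\<delta> > 0\<close> unfolding S_def closure_approachable
      by (simp add: dist_norm) (meson mem_cball_0)
    let ?x = "(1/2) *\<^sub>R (u - v)"
    have "norm ?x \<le> real n"
      using norm_triangle_ineq4[of u v] u v by simp
    moreover have "y - T ?x = (1/2) *\<^sub>R ((T v - (z - y)) - (T u - (z + y)))"
      by (simp add: blinfun.bilinear_simps algebra_simps flip: scaleR_add_left)
    then have "norm (y - T ?x) < \<delta>"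
      using norm_triangle_ineq4[of "T v - (z - y)" "T u - (z + y)"] u v by simp
    ultimately show ?thesis
      by blast
  qed
  show thesis
  proof (rule that[of "2 * real n / r"])
    show "2 * real n / r \<ge> 0"
      using r by simp
  next
    fix y
    show "\<exists>x. norm x \<le> 2 * real n / r * norm y \<and> norm (y - T x) \<le> norm y / 2"
    proof (cases "y = 0")
      case True
      then show ?thesis
        by (intro exI[of _ 0]) simp
    next
      case False
      \<comment> \<open>Dividing by \<open>c\<close> gives \<open>y\<close> the norm
        \<open>r / 2\<close>, inside the ball; multiplying back turns the tolerance
        \<open>r / 4\<close> into \<open>norm y / 2\<close>.\<close>
      define c where "c = 2 * norm y / r"
      have c: "c > 0"
        using False r by (simp add: c_def)
      have "norm ((1 / c) *\<^sub>R y) < r"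
        using False r by (simp add: c_def)
      then obtain x where x: "norm x \<le> real n" "norm ((1 / c) *\<^sub>R y - T x) < r / 4"
        using approx[of "(1 / c) *\<^sub>R y" "r / 4"] r by auto
      have "norm (c *\<^sub>R x) \<le> c * real n"
        using x c by (simp add: mult_left_mono)
      also have "c * real n = 2 * real n / r * norm y"
        by (simp add: c_def)
      finally have 1: "norm (c *\<^sub>R x) \<le> 2 * real n / r * norm y" .
      have "y - T (c *\<^sub>R x) = c *\<^sub>R ((1 / c) *\<^sub>R y - T x)"
        using c by (simp add: blinfun.bilinear_simps algebra_simps)
      then have "norm (y - T (c *\<^sub>R x)) \<le> c * (r / 4)"
        using x c by (simp add: mult_left_mono del: real_scaleR_def)
      also have "c * (r / 4) = norm y / 2"
        using r by (simp add: c_def)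
      finally show ?thesis
        using 1 by blast
    qed
  qed
qed

text \<open>Correcting the residual repeatedly halves it each time, so the corrections form an
  absolutely convergent series; completeness of the domain provides its sum, an exact
  preimage.\<close>

lemma surj_blinfun_bounded_preimage:
  fixes T :: "'a::banach \<Rightarrow>\<^sub>L 'b::banach"
  assumes "surj (blinfun_apply T)"
  obtains K where "K > 0" "\<And>y. \<exists>x. T x = y \<and> norm x \<le> K * norm y"
proof -
  obtain K where K: "K \<ge> 0" "\<And>y. \<exists>x. norm x \<le> K * norm y \<and> norm (y - T x) \<le> norm y / 2"
    using surj_blinfun_approximate_preimage[OF assms] by blast
  then obtain g where g: "\<And>y. norm (g y) \<le> K * norm y" "\<And>y. norm (y - T (g y)) \<le> norm y / 2"
    by metis
  show thesis
  \<comment> \<open>The geometric series yields \<open>2 * K\<close>; the added 1 secures strict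
    positivity, as \<open>K\<close> may be 0.\<close>
  proof (rule that[of "2 * K + 1"])
    show "2 * K + 1 > 0"
      using K by simp
  next
    fix y
    \<comment> \<open>\<open>R k\<close> is the residual after \<open>k\<close> corrections, so
      \<open>T (g (R k))\<close> is \<open>R k - R (Suc k)\<close> and the image series telescopes
      to \<open>y\<close>.\<close>
    define R where "R k = ((\<lambda>u. u - T (g u)) ^^ k) y" for k
    have R_Suc: "R (Suc k) = R k - T (g (R k))" for k
      by (simp add: R_def)
    have R_le: "norm (R k) \<le> norm y * (1/2) ^ k" for k
    proof (induction k)
      case 0
      then show ?case by (simp add: R_def)
    next
      case (Suc k)
      then show ?case
        using g(2)[of "R k"] by (simp add: R_Suc)
    qed
    have gR: "norm (g (R k)) \<le> K * norm y * (1/2) ^ k" for k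
      using order_trans[OF g(1)[of "R k"] mult_left_mono[OF R_le K(1)]] by (simp add: mult.assoc)
    have geo: "(\<lambda>k. K * norm y * (1/2) ^ k) sums (K * norm y * 2)"
      using sums_mult[OF geometric_sums[of "1/2::real"], of "K * norm y"] by simp
    have summ_norm: "summable (\<lambda>k. norm (g (R k)))"
      by (rule summable_comparison_test'[OF sums_summable[OF geo], of 0]) (use gR in auto)
    define x where "x = (\<Sum>k. g (R k))"
    have "(\<lambda>k. g (R k)) sums x"
      unfolding x_def by (rule summable_sums[OF summable_norm_cancel[OF summ_norm]])
    then have "(\<lambda>k. T (g (R k))) sums T x"
      by (rule bounded_linear.sums[OF blinfun.bounded_linear_right])
    moreover have "(\<lambda>k. T (g (R k))) sums y"
    proof -
      have "(\<lambda>k. norm y * (1/2) ^ k) \<longlonglongrightarrow> norm y * 0"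
        by (intro tendsto_mult tendsto_const LIMSEQ_power_zero) simp
      then have "R \<longlonglongrightarrow> 0"
        by (intro Lim_null_comparison[of R]) (auto intro!: always_eventually R_le)
      then have "(\<lambda>k. R k - R (Suc k)) sums (R 0 - 0)"
        by (rule telescope_sums')
      then show ?thesis
        by (simp add: R_Suc) (simp add: R_def)
    qed
    ultimately have "T x = y"
      by (rule sums_unique2)
    moreover have "norm x \<le> (2 * K + 1) * norm y"
    proof -
      have "norm x \<le> (\<Sum>k. norm (g (R k)))"
        unfolding x_def by (rule summable_norm[OF summ_norm])
      also have "\<dots> \<le> K * norm y * 2"
        using suminf_le[OF gR summ_norm sums_summable[OF geo]] sums_unique[OF geo] by simp
      also have "\<dots> \<le> (2 * K + 1) * norm y"
        by (simp add: algebra_simps)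
      finally show ?thesis .
    qed
    ultimately show "\<exists>x. T x = y \<and> norm x \<le> (2 * K + 1) * norm y"
      by blast
  qed
qed

lemma bij_blinfun_bounded_below:
  fixes T :: "'a::banach \<Rightarrow>\<^sub>L 'b::banach"
  assumes "bij (blinfun_apply T)"
  obtains K where "K > 0" "\<And>x. norm x \<le> K * norm (T x)"
  using surj_blinfun_bounded_preimage[OF bij_is_surj[OF assms]] bij_is_inj[OF assms]
  by (metis injD)

section \<open>Stability of the derivative and linearization near a point\<close>

text \<open>After multiplication by \<open>K\<close>, replacing \<open>T\<close> by \<open>A\<close>
  costs at most \<open>norm x / 2\<close>, which the left-hand side absorbs; hence the factor
  2.\<close>

lemma blinfun_bounded_below_perturb:
  fixes A T :: "'a::real_normed_vector \<Rightarrow>\<^sub>L 'b::real_normed_vector"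
  assumes K: "K > 0" "\<And>x. norm x \<le> K * norm (T x)"
    and close: "norm (A - T) \<le> 1 / (2 * K)"
  shows "norm x \<le> 2 * K * norm (A x)"
proof -
  have "norm (T x) \<le> norm (A x) + norm ((A - T) x)"
    using norm_triangle_ineq4[of "A x" "(A - T) x"] by (simp add: blinfun.bilinear_simps)
  also have "norm ((A - T) x) \<le> 1 / (2 * K) * norm x"
    by (rule order_trans[OF norm_blinfun mult_right_mono[OF close norm_ge_zero]])
  finally have "K * norm (T x) \<le> K * (norm (A x) + 1 / (2 * K) * norm x)"
    using K(1) by simp
  also have "\<dots> = K * norm (A x) + norm x / 2"
    using K(1) by (simp add: field_simps)
  finally show ?thesis
    using K(2)[of x] by simp
qed

text \<open>The expansion is centred at \<open>z\<close> rather than \<open>x\<close> because the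
  discrete problem involves the derivative at the discrete solution. The mean value inequality then
  needs the oscillation of \<open>DB\<close> about \<open>DB z\<close>; passing through
  \<open>DB x\<close> doubles \<delta>.\<close>

lemma C1_on_linearization:
  assumes "open D" "C1_on D B DB" "x \<in> D" "\<delta> > 0"
  obtains \<epsilon> where "\<epsilon> > 0"
    "\<And>z. norm (x - z) < \<epsilon> \<Longrightarrow> z \<in> D \<and> norm (DB z - DB x) \<le> \<delta>"
    "\<And>z. norm (x - z) < \<epsilon> \<Longrightarrow> norm (B x - B z - DB z (x - z)) \<le> 2 * \<delta> * norm (x - z)"
proof -
  have cont: "continuous_on D DB"
    and deriv: "\<And>z. z \<in> D \<Longrightarrow> (B has_derivative blinfun_apply (DB z)) (at z)"
    using assms(2) by (auto simp: C1_on_def)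
  obtain e1 where e1: "e1 > 0" "ball x e1 \<subseteq> D"
    using assms open_contains_ball by blast
  obtain e2 where e2: "e2 > 0" "\<And>z. z \<in> D \<Longrightarrow> dist z x < e2 \<Longrightarrow> dist (DB z) (DB x) < \<delta>"
    using cont assms(3,4) unfolding continuous_on_iff by blast
  define e where "e = min e1 e2"
  have e: "z \<in> D" "norm (DB z - DB x) \<le> \<delta>" if "z \<in> ball x e" for z
  proof -
    show "z \<in> D"
      using that e1 by (auto simp: e_def)
    then show "norm (DB z - DB x) \<le> \<delta>"
      using that e2(2)[of z] by (simp add: e_def dist_commute flip: dist_norm)
  qed
  show thesis
  proof (rule that[of e])
    show "e > 0"
      using e1 e2 by (simp add: e_def)
  next
    fix z assume z: "norm (x - z) < e"
    then show "z \<in> D \<and> norm (DB z - DB x) \<le> \<delta>"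
      using e[of z] by (simp add: dist_norm)
    have in_ball: "z \<in> ball x e" "x \<in> ball x e"
      using z e1 e2 by (auto simp: e_def dist_norm)
    have "norm (B x - B z - DB z (x - z)) \<le> norm (x - z) * (2 * \<delta>)"
    proof (rule differentiable_bound_linearization[where S = "ball x e"])
      fix t :: real assume "t \<in> {0..1}"
      then show "z + t *\<^sub>R (x - z) \<in> ball x e"
        using convexD[OF convex_ball in_ball, of "1 - t" t] by (simp add: algebra_simps)
    next
      fix u assume "u \<in> ball x e"
      then show "(B has_derivative blinfun_apply (DB u)) (at u within ball x e)"
        using deriv e(1) has_derivative_at_withinI by blast
    next
      fix u assume u: "u \<in> ball x e"
      have "onorm (blinfun_apply (DB u) - blinfun_apply (DB z)) = norm (DB u - DB z)"
        by (simp add: norm_blinfun.rep_eq minus_blinfun.rep_eq fun_diff_def)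
      also have "\<dots> \<le> norm (DB u - DB x) + norm (DB z - DB x)"
        using norm_triangle_ineq4[of "DB u - DB x" "DB z - DB x"] by simp
      also have "\<dots> \<le> 2 * \<delta>"
        using e(2)[OF u] e(2)[OF in_ball(1)] by simp
      finally show "onorm (blinfun_apply (DB u) - blinfun_apply (DB z)) \<le> 2 * \<delta>" .
    qed (use in_ball in auto)
    then show "norm (B x - B z - DB z (x - z)) \<le> 2 * \<delta> * norm (x - z)"
      by (simp add: mult.commute)
  qed
qed

section \<open>Residual estimates for the mixed problem\<close>

lemma mixed_residual_bounds:
  fixes B :: "'x::real_normed_vector \<Rightarrow> 'y::real_inner \<Rightarrow>\<^sub>L real"
  assumes fortin: "fortin_operator D DB Xh Yh P" "norm P \<le> M" "M \<ge> 0"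
    and sol: "mixed_solution D B DB F Xh Yh xh yh"
    and Xh: "subspace Xh" "\<xi> \<in> Xh"
    and Bx: "B x = F"
    and lin: "norm (B x - B xh - DB xh (x - xh)) \<le> \<rho>"
    and L: "norm (DB xh) \<le> L"
  shows "norm yh \<le> L * norm (x - \<xi>) + \<rho>"
    and "norm (DB xh (xh - \<xi>)) \<le> 2 * M * (L * norm (x - \<xi>) + \<rho>)"
proof -
  define s where "s = L * norm (x - \<xi>) + \<rho>"
  \<comment> \<open>By linearity \<open>q\<close> equals
    \<open>DB xh (xh - \<xi>) + (B x - B xh)\<close>, and on \<open>Yh\<close> the last difference
    acts as \<open>inner yh\<close>. The form chosen here exhibits the best-approximation and
    linearization errors, which bound \<open>norm q\<close> by \<open>s\<close>.\<close>
  define q where "q = DB xh (x - \<xi>) + (B x - B xh - DB xh (x - xh))"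
  have xh: "xh \<in> D" "xh \<in> Xh" "yh \<in> Yh"
    using sol by (auto simp: mixed_solution_def)
  have w: "xh - \<xi> \<in> Xh"
    using Xh xh by (intro subspace_diff)
  have "norm (DB xh (x - \<xi>)) \<le> L * norm (x - \<xi>)"
    by (rule order_trans[OF norm_blinfun mult_right_mono[OF L norm_ge_zero]])
  then have q: "norm q \<le> s"
    unfolding q_def s_def using norm_triangle_mono[OF _ lin] by blast
  have s: "s \<ge> 0"
    using q norm_ge_zero order_trans by blast
  have id: "DB xh (xh - \<xi>) \<eta> = q \<eta> - inner yh \<eta>" if "\<eta> \<in> Yh" for \<eta>
  proof -
    have "inner yh \<eta> + B xh \<eta> = B x \<eta>"
      using sol that Bx by (simp add: mixed_solution_def)
    then show ?thesis
      by (simp add: q_def blinfun.bilinear_simps)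
  qed
  have "DB xh (xh - \<xi>) yh = 0"
    using sol w by (simp add: mixed_solution_def)
  then have "norm yh * norm yh = q yh"
    using id[OF xh(3)] by (simp flip: power2_eq_square power2_norm_eq_inner)
  also have "\<dots> \<le> s * norm yh"
    using norm_blinfun[of q yh] mult_right_mono[OF q norm_ge_zero[of yh]] by simp
  finally have yh: "norm yh \<le> s"
    using s by (cases "norm yh = 0") auto
  then show "norm yh \<le> L * norm (x - \<xi>) + \<rho>"
    by (simp add: s_def)
  have "norm (DB xh (xh - \<xi>)) \<le> 2 * M * s"
  proof (rule norm_blinfun_bound)
    show "2 * M * s \<ge> 0"
      using s fortin by simp
  next
    fix y
    \<comment> \<open>\<open>id\<close> holds only on \<open>Yh\<close>; the Fortin property
      replaces an arbitrary \<open>y\<close> by \<open>P y\<close> at the price of the factor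
      \<open>M\<close>.\<close>
    have "DB xh (xh - \<xi>) y - DB xh (xh - \<xi>) (P y) = 0"
      using fortin(1) xh w by (simp add: fortin_operator_def flip: blinfun.diff_right)
    moreover have "P y \<in> Yh"
      using fortin(1) by (auto simp: fortin_operator_def)
    ultimately have "DB xh (xh - \<xi>) y = q (P y) - inner yh (P y)"
      using id by simp
    then have "norm (DB xh (xh - \<xi>) y) \<le> norm (q (P y)) + norm (inner yh (P y))"
      using norm_triangle_ineq4 by metis
    also have "\<dots> \<le> norm q * norm (P y) + norm yh * norm (P y)"
      using norm_blinfun[of q "P y"] Cauchy_Schwarz_ineq2[of yh "P y"] by simp
    also have "\<dots> \<le> s * norm (P y) + s * norm (P y)"
      using q yh by (intro add_mono mult_right_mono) auto
    also have "\<dots> = 2 * s * norm (P y)"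
      by simp
    also have "\<dots> \<le> 2 * s * (M * norm y)"
      using s order_trans[OF norm_blinfun mult_right_mono[OF fortin(2) norm_ge_zero]]
      by (intro mult_left_mono) auto
    finally show "norm (DB xh (xh - \<xi>) y) \<le> 2 * M * s * norm y"
      by (simp add: mult_ac)
  qed
  then show "norm (DB xh (xh - \<xi>)) \<le> 2 * M * (L * norm (x - \<xi>) + \<rho>)"
    by (simp add: s_def)
qed

section \<open>Choice of constants and quasi-optimality\<close>

theorem theorem2p8:
  fixes D :: "'x::banach set"
    and B :: "'x \<Rightarrow> 'y::{real_inner, complete_space} \<Rightarrow>\<^sub>L real"
    and DB :: "'x \<Rightarrow> 'x \<Rightarrow>\<^sub>L ('y \<Rightarrow>\<^sub>L real)"
    and F :: "'y \<Rightarrow>\<^sub>L real"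
    and x :: 'x
    and M :: real
  assumes "open D" and "D \<noteq> {}"
    and "C1_on D B DB"
    and "regular_solution D B DB F x"
  shows "\<exists>\<epsilon>>0. \<exists>C>0. \<forall>Xh Yh.
           finite_dim_subspace Xh \<longrightarrow> finite_dim_subspace Yh \<longrightarrow>
           (\<exists>P. fortin_operator D DB Xh Yh P \<and> norm P \<le> M) \<longrightarrow>
           (\<forall>xh yh. mixed_solution D B DB F Xh Yh xh yh \<longrightarrow> norm (x - xh) < \<epsilon> \<longrightarrow>
              norm (x - xh) + norm yh \<le> C * (INF \<xi>\<in>Xh. norm (x - \<xi>)))"
proof -
  have x: "x \<in> D" "B x = F" "bij (blinfun_apply (DB x))"
    using assms(4) by (auto simp: regular_solution_def)
  obtain K where K: "K > 0" "\<And>\<xi>. norm \<xi> \<le> K * norm (DB x \<xi>)"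
    using bij_blinfun_bounded_below[OF x(3)] by blast
  \<comment> \<open>\<open>M\<close> is an arbitrary real; a bound of at least 1 keeps \<delta>
    positive and below \<open>1 / (2 * K)\<close>.\<close>
  define m where "m = max M 1"
  have m: "m \<ge> 1" "M \<le> m"
    by (auto simp: m_def)
  \<comment> \<open>The perturbed inverse contributes \<open>2 * K\<close>, the residual bound
    \<open>2 * m\<close> and the linearization \<open>2 * \<delta>\<close>; their product is 1/2, so
    the error term can be absorbed.\<close>
  define \<delta> where "\<delta> = 1 / (16 * K * m)"
  have \<delta>: "\<delta> > 0" "16 * K * m * \<delta> = 1"
    using K m by (auto simp: \<delta>_def)
  have \<delta>_le: "\<delta> \<le> 1 / (2 * K)"
    using K m unfolding \<delta>_def by (intro divide_left_mono) auto
  define L where "L = norm (DB x) + \<delta>"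
  have L: "L > 0"
    unfolding L_def using \<delta> norm_ge_zero[of "DB x"] by linarith
  \<comment> \<open>\<open>E\<close> is the quasi-optimality constant for \<open>x - xh\<close>
    alone, its factor 2 coming from that absorption. \<open>C\<close> below adds the bound on
    \<open>yh\<close>, which again involves \<open>norm (x - xh)\<close>.\<close>
  define E where "E = 2 * (1 + 4 * K * m * L)"
  have E: "E > 0"
    unfolding E_def using K m L by (intro mult_pos_pos add_pos_nonneg mult_nonneg_nonneg) auto
  define C where "C = L + (1 + 2 * \<delta>) * E"
  have C: "C > 0"
    unfolding C_def using L \<delta> E by (intro add_pos_pos mult_pos_pos) auto
  obtain \<epsilon> where \<epsilon>: "\<epsilon> > 0"
    "\<And>z. norm (x - z) < \<epsilon> \<Longrightarrow> z \<in> D \<and> norm (DB z - DB x) \<le> \<delta>"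
    "\<And>z. norm (x - z) < \<epsilon> \<Longrightarrow> norm (B x - B z - DB z (x - z)) \<le> 2 * \<delta> * norm (x - z)"
    using C1_on_linearization[OF assms(1,3) x(1) \<delta>(1)] by metis
  have main: "norm (x - xh) + norm yh \<le> C * norm (x - \<xi>)"
    if Xh: "subspace Xh" and P: "fortin_operator D DB Xh Yh P" "norm P \<le> M"
      and sol: "mixed_solution D B DB F Xh Yh xh yh" and near: "norm (x - xh) < \<epsilon>"
      and \<xi>: "\<xi> \<in> Xh" for Xh Yh P xh yh \<xi>
  proof -
    let ?d = "norm (x - \<xi>)" and ?e = "norm (x - xh)"
    have close: "norm (DB xh - DB x) \<le> \<delta>"
      using \<epsilon>(2)[OF near] by simp
    then have DB_le: "norm (DB xh) \<le> L"
      using norm_triangle_ineq2[of "DB xh" "DB x"] by (simp add: L_def)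
    have P_le: "norm P \<le> m" "m \<ge> 0"
      using P(2) m by auto
    note bounds = mixed_residual_bounds[OF P(1) P_le sol Xh \<xi> x(2) \<epsilon>(3)[OF near] DB_le]
    have "norm (xh - \<xi>) \<le> 2 * K * norm (DB xh (xh - \<xi>))"
      by (rule blinfun_bounded_below_perturb[OF K order_trans[OF close \<delta>_le]])
    also have "\<dots> \<le> 2 * K * (2 * m * (L * ?d + 2 * \<delta> * ?e))"
      using bounds(2) K(1) by (intro mult_left_mono) auto
    also have "\<dots> = 4 * K * m * L * ?d + (16 * K * m * \<delta>) * ?e / 2"
      by (simp add: algebra_simps)
    also have "\<dots> = 4 * K * m * L * ?d + ?e / 2"
      by (simp add: \<delta>(2))
    finally have w: "norm (xh - \<xi>) \<le> 4 * K * m * L * ?d + ?e / 2" .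
    have "?e \<le> ?d + norm (xh - \<xi>)"
      using norm_triangle_ineq4[of "x - \<xi>" "xh - \<xi>"] by simp
    with w have e: "?e \<le> E * ?d"
      by (simp add: E_def algebra_simps)
    have "?e + norm yh \<le> L * ?d + (1 + 2 * \<delta>) * ?e"
      using bounds(1) by (simp add: algebra_simps)
    also have "\<dots> \<le> L * ?d + (1 + 2 * \<delta>) * (E * ?d)"
      using e \<delta>(1) by (intro add_left_mono mult_left_mono) auto
    also have "\<dots> = C * ?d"
      by (simp add: C_def algebra_simps)
    finally show ?thesis .
  qed
  show ?thesis
  proof (rule exI[of _ \<epsilon>], intro conjI \<epsilon>(1) exI[of _ C] C allI impI)
    fix Xh Yh xh yh
    assume Xh: "finite_dim_subspace Xh"
      and "\<exists>P. fortin_operator D DB Xh Yh P \<and> norm P \<le> M"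
      and sol: "mixed_solution D B DB F Xh Yh xh yh" "norm (x - xh) < \<epsilon>"
    then obtain P where P: "fortin_operator D DB Xh Yh P" "norm P \<le> M"
      by blast
    have "subspace Xh"
      using Xh by (simp add: finite_dim_subspace_def)
    note main = main[OF this P sol]
    \<comment> \<open>Dividing by \<open>C\<close> makes the left-hand side a lower bound for all
      the distances, so no minimizer is required.\<close>
    have "(norm (x - xh) + norm yh) / C \<le> (INF \<xi>\<in>Xh. norm (x - \<xi>))"
    proof (rule cINF_greatest)
      show "Xh \<noteq> {}"
        using sol by (auto simp: mixed_solution_def)
    next
      fix \<xi> assume "\<xi> \<in> Xh"
      then show "(norm (x - xh) + norm yh) / C \<le> norm (x - \<xi>)"
        using main C by (simp add: pos_divide_le_eq mult.commute)
    qed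
    then show "norm (x - xh) + norm yh \<le> C * (INF \<xi>\<in>Xh. norm (x - \<xi>))"
      using C by (simp add: pos_divide_le_eq mult.commute)
  qed
qed

end
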